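(* Let $\Gamma$ be a countable group acting by homeomorphisms on a connected, locally connected, locally compact Hausdorff topological space $X$. If $\mathrm{Fix}(\gamma)=\{x\in X:\gamma x=x\}$ is small for every $\gamma\in\Gamma$ with $\gamma\neq \mathrm{id}$, then $\mathrm{Inn}(X,\Gamma)=\Gamma$, and every orbit equivalence from an action $(X',\Gamma')$ to $(X,\Gamma)$ is equivariant.
   Context: Groups act by homeomorphisms, and all actions are taken to be faithful; $\Gamma$ is identified with its image in the group of homeomorphisms of $X$. A subset $A\subset X$ locally disconnects if there is a connected open set $U\subset X$ such that $U\setminus A$ is not connected. A subset $Z\subset X$ is small if it is closed, has empty interior, and does not locally disconnect. $\mathrm{Inn}(X,\Gamma)$ is the group of homeomorphisms $f$ of $X$ with $f(x)\in\Gamma x$ for every $x\in X$. An orbit equivalence from $(X',\Gamma')$ to $(X,\Gamma)$ is a homeomorphism $f:X'\to X$ which maps the orbit relation of $\Gamma'$ to the orbit relation of $\Gamma$ (that is, $x,y$ lie in the same $\Gamma'$-orbit if and only if $f(x),f(y)$ lie in the same $\Gamma$-orbit). It is equivariant if there is a group isomorphism $\varphi:\Gamma'\to\Gamma$ with $f(\gamma' x)=\varphi(\gamma')f(x)$ for all $\gamma'\in\Gamma'$ and $x\in X'$. *)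

theory Defs
  imports "HOL-Analysis.Analysis" "HOL-Algebra.Group_Action"
begin

text \<open>
  The group acts through a map \<open>\<phi>\<close> into the group of permutations of \<open>topspace X\<close>. These are
  extensional functions, so homeomorphisms of \<open>X\<close> onto itself that agree on \<open>topspace X\<close> are equal.
  Under the identification of a faithfully acting group with its image in the homeomorphism
  group, the group becomes the set \<open>\<phi> ` carrier G\<close>.
\<close>

locale homeo_action = faithful_action G "topspace X" \<phi>
  for G (structure) and X :: "'a topology" and \<phi> +
  assumes homeo: "g \<in> carrier G \<Longrightarrow> homeomorphic_map X X (\<phi> g)"

definition homeos :: "'a topology \<Rightarrow> ('a \<Rightarrow> 'a) set"
  where "homeos X = {f \<in> extensional (topspace X). homeomorphic_map X X f}"

text \<open>\<open>connectedin\<close> counts the empty set as connected.\<close>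

definition locally_disconnects :: "'a topology \<Rightarrow> 'a set \<Rightarrow> bool"
  where "locally_disconnects X A \<longleftrightarrow>
    (\<exists>U. openin X U \<and> connectedin X U \<and> \<not> connectedin X (U - A))"

definition small_in :: "'a topology \<Rightarrow> 'a set \<Rightarrow> bool"
  where "small_in X Z \<longleftrightarrow>
    closedin X Z \<and> X interior_of Z = {} \<and> \<not> locally_disconnects X Z"

definition Inn :: "'a topology \<Rightarrow> ('g, 'm) monoid_scheme \<Rightarrow> ('g \<Rightarrow> 'a \<Rightarrow> 'a) \<Rightarrow> ('a \<Rightarrow> 'a) set"
  where "Inn X G \<phi> = {f \<in> homeos X. \<forall>x \<in> topspace X. f x \<in> orbit G \<phi> x}"

definition orbit_equivalence ::
    "'b topology \<Rightarrow> ('h, 'n) monoid_scheme \<Rightarrow> ('h \<Rightarrow> 'b \<Rightarrow> 'b) \<Rightarrow>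
     'a topology \<Rightarrow> ('g, 'm) monoid_scheme \<Rightarrow> ('g \<Rightarrow> 'a \<Rightarrow> 'a) \<Rightarrow> ('b \<Rightarrow> 'a) \<Rightarrow> bool"
  where "orbit_equivalence X' G' \<phi>' X G \<phi> f \<longleftrightarrow>
    homeomorphic_map X' X f \<and>
    (\<forall>x \<in> topspace X'. \<forall>y \<in> topspace X'.
       orbit G' \<phi>' x = orbit G' \<phi>' y \<longleftrightarrow> orbit G \<phi> (f x) = orbit G \<phi> (f y))"

definition equivariant ::
    "'b topology \<Rightarrow> ('h, 'n) monoid_scheme \<Rightarrow> ('h \<Rightarrow> 'b \<Rightarrow> 'b) \<Rightarrow>
     ('g, 'm) monoid_scheme \<Rightarrow> ('g \<Rightarrow> 'a \<Rightarrow> 'a) \<Rightarrow> ('b \<Rightarrow> 'a) \<Rightarrow> bool"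
  where "equivariant X' G' \<phi>' G \<phi> f \<longleftrightarrow>
    (\<exists>\<psi> \<in> iso G' G. \<forall>g \<in> carrier G'. \<forall>x \<in> topspace X'. f (\<phi>' g x) = \<phi> (\<psi> g) (f x))"

end

theory Submission
  imports Defs
begin

text \<open>
  A homeomorphism \<open>h\<close> that preserves orbits gives a countable closed cover of \<open>X\<close> by the sets
  \<open>{x. h x = g x}\<close>, whose pairwise intersections are small, being fixed point sets up to
  translation. Such a cover is trivial. The interiors of its members are disjoint; let \<open>Y\<close> be the
  complement of their union. If \<open>Y\<close> is nonempty, Baire's theorem in \<open>Y\<close> yields a connected open
  \<open>V\<close> meeting \<open>Y\<close> with \<open>V \<inter> Y\<close> inside a single member \<open>F\<^sub>i\<close>. For \<open>j \<noteq> i\<close> the boundary of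
  \<open>int F\<^sub>j\<close> within \<open>V\<close> lies in \<open>F\<^sub>i \<inter> F\<^sub>j\<close>, which does not disconnect \<open>V\<close>, so \<open>int F\<^sub>j\<close> misses \<open>V\<close>
  and \<open>V \<subseteq> F\<^sub>i\<close>, a contradiction. Hence \<open>X\<close> is partitioned by the interiors and connectedness
  leaves only one. For an orbit equivalence, conjugation embeds \<open>\<Gamma>'\<close> into \<open>\<Gamma>\<close>; the image has the same
  orbits as \<open>\<Gamma>\<close>, and the same argument with the image in place of \<open>\<Gamma>\<close> shows that it is all of \<open>\<Gamma>\<close>.
\<close>

lemma Baire_closed_cover:
  assumes "locally_compact_space X" "Hausdorff_space X" "topspace X \<noteq> {}" "countable I"
    and "\<And>i. i \<in> I \<Longrightarrow> closedin X (F i)" "topspace X \<subseteq> (\<Union>i\<in>I. F i)"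
  obtains i where "i \<in> I" "X interior_of F i \<noteq> {}"
proof -
  have "\<exists>i\<in>I. X interior_of F i \<noteq> {}"
  proof (rule ccontr)
    assume "\<not> ?thesis"
    then have "X interior_of \<Union>(F ` I) = {}"
      using assms(4,5) locally_compact_Hausdorff_imp_regular_space[OF assms(1,2)] assms(1)
      by (intro Baire_category_alt) auto
    moreover have "\<Union>(F ` I) = topspace X"
      using assms by (auto dest: closedin_subset)
    ultimately show False
      using assms(3) by simp
  qed
  then show thesis
    using that by blast
qed

lemma connected_space_open_partition:
  assumes "connected_space X" "\<And>i. i \<in> I \<Longrightarrow> openin X (U i)" "(\<Union>i\<in>I. U i) = topspace X"
    and "\<And>i j. i \<in> I \<Longrightarrow> j \<in> I \<Longrightarrow> i \<noteq> j \<Longrightarrow> U i \<inter> U j = {}"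
    and "i \<in> I" "U i \<noteq> {}"
  shows "U i = topspace X"
proof -
  have "topspace X - U i = (\<Union>j\<in>I - {i}. U j)"
    using assms(3-5) by (auto; blast)
  then have "closedin X (U i)"
    using assms(2,5) by (auto simp: closedin_def openin_subset)
  then show ?thesis
    using assms by (auto simp: connected_space_clopen_in)
qed

lemma small_in_open_subset:
  assumes "small_in X Z" "openin X V" "V \<subseteq> Z"
  shows "V = {}"
  using assms interior_of_maximal[of V Z X] by (auto simp: small_in_def)

text \<open>Overlaps are only required to lie in a small set because the intended \<open>F g\<close>
  are coincidence sets, and two of these meet inside a fixed point set without having to fill
  it.\<close>

lemma countable_closed_cover_small_overlaps:
  assumes "connected_space X" "locally_connected_space X"
    and "locally_compact_space X" "Hausdorff_space X" "topspace X \<noteq> {}"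
    and "countable I" and closed: "\<And>i. i \<in> I \<Longrightarrow> closedin X (F i)"
    and cover: "topspace X \<subseteq> (\<Union>i\<in>I. F i)"
    and small: "\<And>i j. i \<in> I \<Longrightarrow> j \<in> I \<Longrightarrow> i \<noteq> j \<Longrightarrow> \<exists>Z. small_in X Z \<and> F i \<inter> F j \<subseteq> Z"
  shows "\<exists>i\<in>I. F i = topspace X"
proof -
  define U where "U i = X interior_of F i" for i
  define Y where "Y = topspace X - (\<Union>i\<in>I. U i)"
  have U_open: "openin X (U i)" and U_sub: "U i \<subseteq> F i" for i
    by (auto simp: U_def interior_of_subset)
  have U_max: "V \<subseteq> U i" if "openin X V" "V \<subseteq> F i" for V i
    using that by (simp add: U_def interior_of_maximal)
  have disj: "U i \<inter> U j = {}" if ij: "i \<in> I" "j \<in> I" "i \<noteq> j" for i j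
  proof -
    obtain Z where "small_in X Z" "F i \<inter> F j \<subseteq> Z"
      using small[OF ij] by blast
    then show ?thesis
      using small_in_open_subset[of X Z "U i \<inter> U j"] U_open U_sub by blast
  qed
  have "closedin X Y"
    using U_open by (auto simp: Y_def)
  have "Y = {}"
  proof (rule ccontr)
    assume "Y \<noteq> {}"
    have "Y \<subseteq> topspace X"
      by (auto simp: Y_def)
    obtain i where "i \<in> I" and i: "subtopology X Y interior_of (Y \<inter> F i) \<noteq> {}"
    proof (rule Baire_closed_cover[of "subtopology X Y" I "\<lambda>i. Y \<inter> F i"])
      show "locally_compact_space (subtopology X Y)" "Hausdorff_space (subtopology X Y)"
        using assms \<open>closedin X Y\<close>
        by (auto simp: locally_compact_space_closed_subset Hausdorff_space_subtopology)
      show "closedin (subtopology X Y) (Y \<inter> F i)" if "i \<in> I" for i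
        using closed[OF that] by (auto simp: closedin_subtopology)
    qed (use assms \<open>Y \<noteq> {}\<close> \<open>Y \<subseteq> topspace X\<close> in auto)
    obtain y where y: "y \<in> subtopology X Y interior_of (Y \<inter> F i)"
      using i by blast
    obtain W where W: "openin X W" "subtopology X Y interior_of (Y \<inter> F i) = W \<inter> Y"
      using openin_interior_of[of "subtopology X Y" "Y \<inter> F i"] unfolding openin_subtopology by blast
    obtain V where V: "openin X V" "connectedin X V" "y \<in> V" "V \<subseteq> W"
      using \<open>locally_connected_space X\<close> W y unfolding locally_connected_space by blast
    have "W \<inter> Y \<subseteq> F i"
      using W(2) interior_of_subset[of "subtopology X Y" "Y \<inter> F i"] by blast
    then have VY: "V \<inter> Y \<subseteq> F i"
      using V by blast
    have "y \<in> Y"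
      using y W(2) by blast
    \<comment> \<open>An open set inside \<open>F j\<close> lies in \<open>U j\<close>, whereas
      \<open>y\<close> is in \<open>V\<close> and, being in \<open>Y\<close>, in no
      \<open>U j\<close>.\<close>
    have V_not_sub: "\<not> V \<subseteq> F j" if "j \<in> I" for j
      using U_max[OF \<open>openin X V\<close>, of j] that \<open>y \<in> V\<close> \<open>y \<in> Y\<close> by (auto simp: Y_def)
    have miss: "V \<inter> U j = {}" if j: "j \<in> I" "j \<noteq> i" for j
    proof -
      obtain Z where Z: "small_in X Z" "F j \<inter> F i \<subseteq> Z"
        using small[OF j(1) \<open>i \<in> I\<close> j(2)] by blast
      have conn: "connectedin X (V - Z)"
        using Z V by (auto simp: small_in_def locally_disconnects_def)
      define C where "C = X closure_of U j"
      have "C \<subseteq> F j"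
        unfolding C_def by (rule closure_of_minimal) (use U_sub closed j in auto)
      \<comment> \<open>A point of \<open>C\<close> outside \<open>U j\<close> avoids every
        \<open>U k\<close>, since an open set disjoint from \<open>U j\<close> also misses its
        closure. Within \<open>V\<close> it therefore lies in
        \<open>V \<inter> Y \<subseteq> F i\<close> as well as in \<open>F j\<close>, hence in
        \<open>Z\<close>.\<close>
      have clopen: "x \<in> U j" if "x \<in> V" "x \<notin> Z" "x \<in> C" for x
      proof (rule ccontr)
        assume "x \<notin> U j"
        moreover have "x \<notin> U k" if "k \<in> I" "k \<noteq> j" for k
          using openin_Int_closure_of_eq_empty[OF U_open[of k], of "U j"] disj[OF that(1) j(1) that(2)]
            \<open>x \<in> C\<close> by (auto simp: C_def)
        ultimately have "x \<in> Y"
          using V(1) \<open>x \<in> V\<close> openin_subset by (fastforce simp: Y_def)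
        then show False
          using VY that Z \<open>C \<subseteq> F j\<close> by blast
      qed
      have E2: "openin X (topspace X - C)"
        by (auto simp: C_def)
      \<comment> \<open>By \<open>clopen\<close>, \<open>U j\<close> and the complement of its
        closure are disjoint open sets covering the connected set \<open>V - Z\<close>.\<close>
      have "U j \<inter> (V - Z) = {} \<or> (topspace X - C) \<inter> (V - Z) = {}"
      proof (rule ccontr)
        assume "\<not> ?thesis"
        moreover have "V - Z \<subseteq> U j \<union> (topspace X - C)"
          using clopen openin_subset[OF V(1)] by blast
        moreover have "U j \<inter> (topspace X - C) \<inter> (V - Z) = {}"
          using closure_of_subset[OF openin_subset[OF U_open[of j]]] by (auto simp: C_def)
        ultimately show False
          using connectedinD[OF conn U_open[of j] E2] by blast
      qed
      then show ?thesis
      proof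
        assume "U j \<inter> (V - Z) = {}"
        then show ?thesis
          using small_in_open_subset[OF Z(1), of "V \<inter> U j"] V(1) U_open[of j] by blast
      next
        assume "(topspace X - C) \<inter> (V - Z) = {}"
        \<comment> \<open>In either case an open set is trapped in \<open>Z\<close> and hence empty:
          \<open>V \<inter> U j\<close> before, \<open>V - F j\<close> here, the latter
          contradicting \<open>V_not_sub\<close>.\<close>
        then have "V - F j \<subseteq> Z"
          using \<open>C \<subseteq> F j\<close> openin_subset[OF V(1)] by blast
        then have "V - F j = {}"
          using small_in_open_subset[OF Z(1), of "V - F j"] V(1) closed[OF j(1)] by blast
        then show ?thesis
          using V_not_sub[OF j(1)] by blast
      qed
    qed
    have "V \<subseteq> F i"
    proof
      fix x assume "x \<in> V"
      then have "x \<in> Y \<or> x \<in> U i"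
        using miss openin_subset[OF V(1)] by (auto simp: Y_def)
      then show "x \<in> F i"
        using VY U_sub \<open>x \<in> V\<close> by blast
    qed
    then show False
      using V_not_sub \<open>i \<in> I\<close> by blast
  qed
  then have union: "(\<Union>i\<in>I. U i) = topspace X"
    using openin_subset[OF U_open] by (auto simp: Y_def)
  then obtain i where "i \<in> I" "U i \<noteq> {}"
    using \<open>topspace X \<noteq> {}\<close> by blast
  then have "U i = topspace X"
    using connected_space_open_partition[of X I U] assms(1) U_open union disj by blast
  then show ?thesis
    using U_sub[of i] closedin_subset[OF closed] \<open>i \<in> I\<close> by blast
qed

section \<open>Orbits and coincidence sets\<close>

context homeo_action
begin

lemma action_closed: "g \<in> carrier G \<Longrightarrow> x \<in> topspace X \<Longrightarrow> \<phi> g x \<in> topspace X"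
  using element_image by blast

lemma action_eqI:
  assumes "g \<in> carrier G" "h \<in> carrier G" "\<And>x. x \<in> topspace X \<Longrightarrow> \<phi> g x = \<phi> h x"
  shows "g = h"
proof -
  have "\<phi> g = \<phi> h"
    using assms bij_prop0 by (meson Bij_imp_extensional extensionalityI)
  then show ?thesis
    using assms faithful by (meson inj_onD)
qed

text \<open>Converts the equality of orbits used in \<open>orbit_equivalence\<close> into the
  existence of a group element, the form needed for covering by coincidence sets.\<close>

lemma orbit_eq_iff:
  assumes "x \<in> topspace X" "y \<in> topspace X"
  shows "orbit G \<phi> x = orbit G \<phi> y \<longleftrightarrow> (\<exists>g\<in>carrier G. y = \<phi> g x)"
proof
  assume "orbit G \<phi> x = orbit G \<phi> y"
  then show "\<exists>g\<in>carrier G. y = \<phi> g x"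
    using orbit_refl[OF assms(2)] by (auto simp: orbit_def)
next
  assume "\<exists>g\<in>carrier G. y = \<phi> g x"
  then have yx: "y \<in> orbit G \<phi> x"
    by (auto simp: orbit_def)
  then have xy: "x \<in> orbit G \<phi> y"
    using orbit_sym assms by blast
  have "orbit G \<phi> z \<subseteq> topspace X" if "z \<in> topspace X" for z
    using that action_closed by (auto simp: orbit_def)
  then show "orbit G \<phi> x = orbit G \<phi> y"
    using orbit_trans[OF assms(1,2) _ yx] orbit_trans[OF assms(2,1) _ xy] assms by blast
qed

lemma coincidence_subset_invariants:
  assumes "g \<in> carrier G" "h \<in> carrier G"
  shows "{x \<in> topspace X. \<phi> g x = \<phi> h x} \<subseteq> invariants (topspace X) \<phi> (inv h \<otimes> g)"
proof -
  interpret group G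
    using group_hom group_hom.axioms(1) by auto
  show ?thesis
    using assms orbit_sym_aux[OF assms(2)] composition_rule[of _ "inv h" g]
    by (auto simp: invariants_def)
qed

end

section \<open>Actions with small fixed point sets\<close>

locale small_homeo_action = homeo_action +
  assumes connected: "connected_space X"
    and locally_connected: "locally_connected_space X"
    and locally_compact: "locally_compact_space X"
    and Hausdorff: "Hausdorff_space X"
    and countable: "countable (carrier G)"
    and small: "g \<in> carrier G \<Longrightarrow> g \<noteq> \<one> \<Longrightarrow> small_in X (invariants (topspace X) \<phi> g)"
begin

text \<open>Allowing a subset \<open>S\<close> is what makes the embedding of \<open>\<Gamma>'\<close> into \<open>\<Gamma>\<close> surjective.\<close>

lemma pointwise_in_subset_imp_uniform:
  assumes "S \<subseteq> carrier G" "S \<noteq> {}" "continuous_map X X h"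
    and cover: "\<And>x. x \<in> topspace X \<Longrightarrow> \<exists>g\<in>S. h x = \<phi> g x"
  shows "\<exists>g\<in>S. \<forall>x\<in>topspace X. h x = \<phi> g x"
proof (cases "topspace X = {}")
  case True
  then show ?thesis
    using assms by auto
next
  case False
  interpret group G
    using group_hom group_hom.axioms(1) by auto
  \<comment> \<open>Coincidence sets are closed because \<open>X\<close> is Hausdorff. On the
    overlap for \<open>g\<close> and \<open>k\<close>, the element \<open>inv k \<otimes> g\<close>
    fixes every point, and it is not the identity.\<close>
  have "\<exists>g\<in>S. {x \<in> topspace X. h x = \<phi> g x} = topspace X"
  proof (rule countable_closed_cover_small_overlaps)
    show "countable S"
      using assms(1) countable countable_subset by blast
    show "closedin X {x \<in> topspace X. h x = \<phi> g x}" if "g \<in> S" for g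
      using that assms homeo homeomorphic_imp_continuous_map Hausdorff
      by (blast intro: closedin_continuous_maps_eq)
    fix g k assume "g \<in> S" "k \<in> S" "g \<noteq> k"
    then have gk: "g \<in> carrier G" "k \<in> carrier G"
      using assms(1) by auto
    then have "inv k \<otimes> g \<noteq> \<one>"
      using \<open>g \<noteq> k\<close> by (metis inv_closed inv_equality inv_inv)
    then have "small_in X (invariants (topspace X) \<phi> (inv k \<otimes> g))"
      using small gk by simp
    then show "\<exists>Z. small_in X Z \<and> {x \<in> topspace X. h x = \<phi> g x} \<inter> {x \<in> topspace X. h x = \<phi> k x} \<subseteq> Z"
      using coincidence_subset_invariants[OF gk] by fastforce
  qed (use False cover connected locally_connected locally_compact Hausdorff in auto)
  then show ?thesis
    by blast
qed

lemma Inn_eq: "Inn X G \<phi> = \<phi> ` carrier G"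
proof
  interpret group G
    using group_hom group_hom.axioms(1) by auto
  show "\<phi> ` carrier G \<subseteq> Inn X G \<phi>"
    using homeo bij_prop0 by (auto simp: Inn_def homeos_def Bij_def orbit_def)
  show "Inn X G \<phi> \<subseteq> \<phi> ` carrier G"
  proof
    fix h assume h: "h \<in> Inn X G \<phi>"
    then have "continuous_map X X h"
      by (auto simp: Inn_def homeos_def homeomorphic_imp_continuous_map)
    then obtain g where "g \<in> carrier G" "\<forall>x\<in>topspace X. h x = \<phi> g x"
      using pointwise_in_subset_imp_uniform[of "carrier G" h] h
      by (auto simp: Inn_def orbit_def)
    moreover from this have "h = \<phi> g"
      using h bij_prop0 by (auto simp: Inn_def homeos_def Bij_def intro: extensionalityI)
    ultimately show "h \<in> \<phi> ` carrier G"
      by blast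
  qed
qed

lemma orbit_equivalence_equivariant:
  assumes act: "homeo_action G' X' \<phi>'" and equ: "orbit_equivalence X' G' \<phi>' X G \<phi> f"
  shows "equivariant X' G' \<phi>' G \<phi> f"
proof -
  interpret G': homeo_action G' X' \<phi>'
    by (fact act)
  interpret group G
    using group_hom group_hom.axioms(1) by auto
  interpret grp': group G'
    using G'.group_hom group_hom.axioms(1) by auto
  have f_hom: "homeomorphic_map X' X f"
    and f_orb: "\<And>x y. x \<in> topspace X' \<Longrightarrow> y \<in> topspace X' \<Longrightarrow>
      orbit G' \<phi>' x = orbit G' \<phi>' y \<longleftrightarrow> orbit G \<phi> (f x) = orbit G \<phi> (f y)"
    using equ by (auto simp: orbit_equivalence_def)
  have f_im: "f ` topspace X' = topspace X" and f_inj: "inj_on f (topspace X')"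
    using f_hom homeomorphic_imp_surjective_map homeomorphic_imp_injective_map by blast+
  then have f_closed: "f x \<in> topspace X" if "x \<in> topspace X'" for x
    using that by blast
  obtain e where e: "continuous_map X X' e" and ef: "\<And>x. x \<in> topspace X' \<Longrightarrow> e (f x) = x"
    using f_hom by (auto simp: homeomorphic_map_maps homeomorphic_maps_def)
  have orb: "(\<exists>g\<in>carrier G'. y = \<phi>' g x) \<longleftrightarrow> (\<exists>g\<in>carrier G. f y = \<phi> g (f x))"
    if "x \<in> topspace X'" "y \<in> topspace X'" for x y
    using f_orb[OF that] G'.orbit_eq_iff[OF that] orbit_eq_iff[of "f x" "f y"] that f_closed by simp
  \<comment> \<open>The smallness hypotheses concern \<open>X\<close>, so \<open>\<phi>' g\<close>
    is transported there by conjugation with \<open>f\<close>; the result moves each point within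
    its \<open>G\<close>-orbit.\<close>
  have "\<exists>k\<in>carrier G. \<forall>x\<in>topspace X'. f (\<phi>' g x) = \<phi> k (f x)" if g: "g \<in> carrier G'" for g
  proof -
    have "continuous_map X X (f \<circ> \<phi>' g \<circ> e)"
      using e G'.homeo[OF g] f_hom
      by (meson continuous_map_compose homeomorphic_imp_continuous_map)
    moreover have "\<exists>k\<in>carrier G. (f \<circ> \<phi>' g \<circ> e) x = \<phi> k x" if x: "x \<in> topspace X" for x
    proof -
      obtain z where z: "z \<in> topspace X'" "x = f z"
        using x f_im by blast
      then show ?thesis
        using orb[OF z(1) G'.action_closed[OF g z(1)]] g ef by auto
    qed
    ultimately obtain k where k: "k \<in> carrier G" "\<forall>x\<in>topspace X. (f \<circ> \<phi>' g \<circ> e) x = \<phi> k x"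
      using pointwise_in_subset_imp_uniform[of "carrier G" "f \<circ> \<phi>' g \<circ> e"] by blast
    then have "\<forall>x\<in>topspace X'. f (\<phi>' g x) = \<phi> k (f x)"
      using f_closed ef by force
    with k(1) show ?thesis
      by blast
  qed
  then obtain \<psi> where \<psi>_closed: "\<And>g. g \<in> carrier G' \<Longrightarrow> \<psi> g \<in> carrier G"
    and \<psi>: "\<And>g x. g \<in> carrier G' \<Longrightarrow> x \<in> topspace X' \<Longrightarrow> f (\<phi>' g x) = \<phi> (\<psi> g) (f x)"
    by metis
  \<comment> \<open>Since \<open>f\<close> is onto and the action faithful, \<open>\<psi>\<close> is
    determined by its intertwining relation, which makes it multiplicative.\<close>
  have eqI: "g = h" if "g \<in> carrier G" "h \<in> carrier G"
    "\<And>x. x \<in> topspace X' \<Longrightarrow> \<phi> g (f x) = \<phi> h (f x)" for g h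
    using that f_im by (metis action_eqI imageE)
  have "\<psi> \<in> hom G' G"
  proof (rule homI)
    fix a b assume ab: "a \<in> carrier G'" "b \<in> carrier G'"
    show "\<psi> (a \<otimes>\<^bsub>G'\<^esub> b) = \<psi> a \<otimes> \<psi> b"
    proof (rule eqI)
      fix x assume x: "x \<in> topspace X'"
      have "\<phi> (\<psi> (a \<otimes>\<^bsub>G'\<^esub> b)) (f x) = f (\<phi>' a (\<phi>' b x))"
        using \<psi>[of "a \<otimes>\<^bsub>G'\<^esub> b" x] ab x G'.composition_rule by simp
      also have "\<dots> = \<phi> (\<psi> a \<otimes> \<psi> b) (f x)"
        using ab x \<psi> G'.action_closed \<psi>_closed composition_rule[of "f x"] f_closed by simp
      finally show "\<phi> (\<psi> (a \<otimes>\<^bsub>G'\<^esub> b)) (f x) = \<phi> (\<psi> a \<otimes> \<psi> b) (f x)" .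
    qed (use ab \<psi>_closed in auto)
  qed (rule \<psi>_closed)
  moreover have "bij_betw \<psi> (carrier G') (carrier G)"
    unfolding bij_betw_def
  proof
    show "inj_on \<psi> (carrier G')"
    proof (rule inj_onI, rule G'.action_eqI)
      fix a b x assume "a \<in> carrier G'" "b \<in> carrier G'" "\<psi> a = \<psi> b" "x \<in> topspace X'"
      then show "\<phi>' a x = \<phi>' b x"
        using \<psi>[of a x] \<psi>[of b x] G'.action_closed f_inj by (metis inj_onD)
    qed
    show "\<psi> ` carrier G' = carrier G"
    proof
      show "carrier G \<subseteq> \<psi> ` carrier G'"
      proof
        fix g assume g: "g \<in> carrier G"
        \<comment> \<open>The reverse direction of \<open>orb\<close> gives
          \<open>\<phi> g (f z) = f (\<phi>' a z) = \<phi> (\<psi> a) (f z)\<close> with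
          \<open>a\<close> depending on \<open>z\<close>. Uniformity over the image of
          \<open>\<psi>\<close> then removes this dependence.\<close>
        have "\<exists>k\<in>\<psi> ` carrier G'. \<phi> g x = \<phi> k x" if x: "x \<in> topspace X" for x
        proof -
          obtain z where z: "z \<in> topspace X'" "x = f z"
            using x f_im by blast
          obtain w where w: "w \<in> topspace X'" "\<phi> g x = f w"
            using action_closed[OF g x] f_im by blast
          then obtain a where "a \<in> carrier G'" "w = \<phi>' a z"
            using orb[OF z(1) w(1)] g z w by metis
          then show ?thesis
            using \<psi> z w by auto
        qed
        then obtain k where k: "k \<in> \<psi> ` carrier G'" "\<forall>x\<in>topspace X. \<phi> g x = \<phi> k x"
          using pointwise_in_subset_imp_uniform[of "\<psi> ` carrier G'" "\<phi> g"] \<psi>_closed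
            homeomorphic_imp_continuous_map[OF homeo[OF g]] grp'.one_closed by blast
        then have "g = k"
          using g \<psi>_closed by (intro action_eqI) auto
        then show "g \<in> \<psi> ` carrier G'"
          using k(1) by simp
      qed
    qed (use \<psi>_closed in auto)
  qed
  ultimately show ?thesis
    using \<psi> by (auto simp: equivariant_def iso_def)
qed

end

theorem theorem3p4:
  fixes X :: "'a topology" and G :: "('g, 'm) monoid_scheme" and \<phi> :: "'g \<Rightarrow> 'a \<Rightarrow> 'a"
  assumes "connected_space X" and "locally_connected_space X"
    and "locally_compact_space X" and "Hausdorff_space X"
    and "homeo_action G X \<phi>"
    and "countable (carrier G)"
    and "\<And>g. g \<in> carrier G \<Longrightarrow> g \<noteq> \<one>\<^bsub>G\<^esub> \<Longrightarrow> small_in X (invariants (topspace X) \<phi> g)"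
  shows "Inn X G \<phi> = \<phi> ` carrier G \<and>
    (\<forall>(X' :: 'b topology) (G' :: ('h, 'n) monoid_scheme) \<phi>' f.
       homeo_action G' X' \<phi>' \<longrightarrow> orbit_equivalence X' G' \<phi>' X G \<phi> f \<longrightarrow>
       equivariant X' G' \<phi>' G \<phi> f)"
proof -
  interpret small_homeo_action G X \<phi>
    using assms by (simp add: small_homeo_action_def small_homeo_action_axioms_def)
  show ?thesis
    using Inn_eq orbit_equivalence_equivariant by blast
qed

end
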